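(* Let $I\subset\mathbb{R}$ be a compact nondegenerate interval, let $\mathcal{F}_1$ be the set of all continuous maps $I\to I$ that do not admit a $2$-cycle, and let $f\in\mathcal{F}_1$. The following are equivalent: (a) $f$ is universal in $\mathcal{F}_1$, i.e. for every $g\in\mathcal{F}_1$ and every $y\in I$ there exists $x\in I$ such that $(f^n(x))_{n=0}^{\infty}$ and $(g^n(y))_{n=0}^{\infty}$ have the same order-pattern. (b) $f$ admits a fixed point $p\in I$ such that arbitrarily near $p$, on both sides of $p$, the values taken by $f$ swing both above and below $p$; that is, for every $\varepsilon>0$ there exist $x_1,x_2\in I\cap(p,p+\varepsilon)$ and $x_3,x_4\in I\cap(p-\varepsilon,p)$ with $f(x_1)>p$, $f(x_2)<p$, $f(x_3)>p$ and $f(x_4)<p$.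
   Context: A $2$-cycle of a map $h$ is a pair of distinct points $u\neq v$ with $h(u)=v$ and $h(v)=u$. Here $h^n$ denotes the $n$-th iterate of $h$, with $h^0$ the identity. Two real sequences $(a_n)_{n=0}^{\infty}$ and $(b_n)_{n=0}^{\infty}$ have the same order-pattern if, for all $m,n\ge 0$, $a_m<a_n\iff b_m<b_n$. *)

theory Defs
  imports "HOL-Analysis.Analysis"
begin

definition same_order_pattern :: "(nat \<Rightarrow> real) \<Rightarrow> (nat \<Rightarrow> real) \<Rightarrow> bool" where
  "same_order_pattern a b \<longleftrightarrow> (\<forall>m n. a m < a n \<longleftrightarrow> b m < b n)"

definition admits_2_cycle :: "real set \<Rightarrow> (real \<Rightarrow> real) \<Rightarrow> bool" where
  "admits_2_cycle I h \<longleftrightarrow> (\<exists>u\<in>I. \<exists>v\<in>I. u \<noteq> v \<and> h u = v \<and> h v = u)"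

(* A map from I to I is represented by a total function on the reals that sends I into I;
   its values outside I are arbitrary, and nothing below depends on them. *)
definition F1 :: "real set \<Rightarrow> (real \<Rightarrow> real) set" where
  "F1 I = {h. h \<in> I \<rightarrow> I \<and> continuous_on I h \<and> \<not> admits_2_cycle I h}"

definition universal_in :: "real set \<Rightarrow> (real \<Rightarrow> real) set \<Rightarrow> (real \<Rightarrow> real) \<Rightarrow> bool" where
  "universal_in I F f \<longleftrightarrow>
     (\<forall>g\<in>F. \<forall>y\<in>I. \<exists>x\<in>I. same_order_pattern (\<lambda>n. (f ^^ n) x) (\<lambda>n. (g ^^ n) y))"

end

theory Submission
  imports Defs
begin

text \<open>Without 2-cycles, a point that moves up (down) at the first step has its whole later orbit
  above (below) it, so the order-pattern of an orbit is determined by the signs of its steps.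
  Near a fixed point \<open>p\<close> of the kind in (b), for all prescribed sides of \<open>p\<close> there are intervals
  arbitrarily close to \<open>p\<close> on one side whose image covers a one-sided neighbourhood of \<open>p\<close> on the
  other, and whose points move towards \<open>p\<close>; chaining them realises every sequence of signs.
  Conversely, if \<open>f\<close> realises the periodic sequence up, up, down, down, then the up-points increase
  to some \<open>u\<close> and the down-points decrease to some \<open>v\<close>. The transition up-up gives \<open>f u = u\<close>, the
  transition up-down gives \<open>f u = v\<close>, and the orbit itself provides the points required in (b).\<close>

section \<open>Orbits of interval maps without 2-cycles\<close>

text \<open>Otherwise \<open>f (f y) > y\<close>, equality being a 2-cycle. Let \<open>p\<close> be
  the least fixed point above \<open>y\<close>; on \<open>[y,p)\<close> the map moves points down. A
  point \<open>x\<close> just left of \<open>p\<close> has \<open>y < f x < x\<close>, so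
  \<open>f (f x) < f x < x\<close>. Then \<open>f (f x) - x\<close> changes sign on
  \<open>[y,x]\<close>, and a zero there is a fixed point before \<open>p\<close>.\<close>

lemma down_step_down:
  fixes f :: "real \<Rightarrow> real"
  assumes f: "f \<in> F1 {a..b}" and y: "y \<in> {a..b}" "f y < y"
  shows "f (f y) < y"
proof (rule ccontr)
  assume neg: "\<not> f (f y) < y"
  have cont: "continuous_on {a..b} f" and maps: "\<And>x. x \<in> {a..b} \<Longrightarrow> f x \<in> {a..b}"
    and nocyc: "\<And>x. x \<in> {a..b} \<Longrightarrow> f (f x) = x \<Longrightarrow> f x = x"
    using f unfolding F1_def admits_2_cycle_def by (auto simp: Pi_iff; metis atLeastAtMost_iff)+
  have cont2: "continuous_on {a..b} (\<lambda>x. f (f x))"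
    using continuous_on_compose2[OF cont cont] maps by blast
  have "f (f y) \<noteq> y" using nocyc y by force
  with neg have up: "f (f y) > y" by simp
  \<comment> \<open>A zero of \<open>f (f x) - x\<close> is a fixed point of \<open>f\<close>, since
    a 2-cycle is excluded.\<close>
  have root: "\<exists>r. y \<le> r \<and> r \<le> z \<and> f r = r" if "z \<in> {y..b}" "f (f z) \<le> z" for z
  proof -
    have "\<exists>x. y \<le> x \<and> x \<le> z \<and> f (f x) - x = 0"
      using that up y by (intro IVT2' continuous_intros continuous_on_subset[OF cont2]) auto
    then obtain r where r: "y \<le> r" "r \<le> z" "f (f r) = r" by auto
    with nocyc[of r] that y show ?thesis by auto
  qed
  define S where "S = {x \<in> {y..b}. f x - x = 0}"
  have "closed S" unfolding S_def
    using y by (intro continuous_closed_preimage_constant continuous_intros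
        continuous_on_subset[OF cont]) auto
  \<comment> \<open>At \<open>z = b\<close> the condition \<open>f (f z) \<le> z\<close> holds
    because \<open>f\<close> maps into the interval.\<close>
  moreover have "S \<noteq> {}" using root[of b] maps[of "f b"] maps[of b] y unfolding S_def by auto
  moreover have bb: "bdd_below S" unfolding S_def by (auto intro!: bdd_belowI)
  ultimately have "Inf S \<in> S" by (intro closed_contains_Inf)
  define p where "p = Inf S"
  have p: "y \<le> p" "p \<le> b" "f p = p" using \<open>Inf S \<in> S\<close> unfolding p_def S_def by auto
  have first: "p \<le> x" if "y \<le> x" "x \<le> b" "f x = x" for x
    unfolding p_def using that by (intro cInf_lower bb) (auto simp: S_def)
  have "y < p" using p y by (cases "y = p") auto
  have below: "f x < x" if "y \<le> x" "x < p" for x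
  proof (rule ccontr)
    assume "\<not> f x < x"
    then have "\<exists>r. y \<le> r \<and> r \<le> x \<and> f r - r = 0"
      using that y p by (intro IVT' continuous_intros continuous_on_subset[OF cont]) auto
    then show False using first that p by force
  qed
  \<comment> \<open>Clamping to \<open>[a,b]\<close> extends \<open>f\<close> continuously to the
    whole line, so that \<open>p = b\<close> needs no separate treatment.\<close>
  have "isCont (\<lambda>x. f (max a (min b x))) p"
    by (rule continuous_on_interior[of UNIV], rule continuous_on_compose2[OF cont])
       (use y in \<open>auto intro!: continuous_intros\<close>)
  moreover have "f (max a (min b p)) > y" using p \<open>y < p\<close> y by simp
  ultimately have "eventually (\<lambda>x. f (max a (min b x)) > y) (at p)"
    unfolding isCont_def by (rule order_tendstoD)
  then obtain d where d: "d > 0" "\<And>x. x \<noteq> p \<Longrightarrow> dist x p < d \<Longrightarrow> f (max a (min b x)) > y"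
    unfolding eventually_at by blast
  define x where "x = max y (p - d / 2)"
  have x: "y \<le> x" "x < p" using d \<open>y < p\<close> unfolding x_def by auto
  have "dist x p < d" using x d by (auto simp: x_def dist_real_def)
  then have "f x > y" using d(2)[of x] x y p by simp
  moreover have "f x < x" using below x by blast
  ultimately have "f (f x) < x" using below[of "f x"] x by simp
  then obtain r where "y \<le> r" "r \<le> x" "f r = r" using root[of x] x p by auto
  then show False using below[of r] x by auto
qed

lemma iterate_in:
  assumes "h \<in> F1 I" "x \<in> I"
  shows "(h ^^ n) x \<in> I"
  using assms by (induction n) (auto simp: F1_def)

text \<open>Suppose the orbit first falls back to \<open>x\<close> or below right after
  \<open>z\<close>. Let \<open>q\<close> be the last fixed point in \<open>[x,z]\<close>, so that
  points of \<open>(q,z]\<close> move down. Then \<open>f\<close> keeps \<open>[x,z)\<close> below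
  \<open>z\<close>, and the orbit, starting in \<open>[x,z)\<close>, could never have reached
  \<open>z\<close>.\<close>

lemma iterates_above:
  fixes f :: "real \<Rightarrow> real"
  assumes f: "f \<in> F1 {a..b}" and x: "x \<in> {a..b}" "x < f x"
  shows "x < (f ^^ Suc k) x"
proof (induction k rule: less_induct)
  case (less m)
  show ?case
  proof (cases m)
    case 0
    then show ?thesis using x by simp
  next
    case (Suc k)
    have prev: "x \<le> (f ^^ i) x" if "i \<le> Suc k" for i
      using less.IH[of "i - 1"] that Suc by (cases i) auto
    show ?thesis
    proof (rule ccontr)
      define z where "z = (f ^^ Suc k) x"
      assume "\<not> x < (f ^^ Suc m) x"
      then have fz: "f z \<le> x" by (simp add: z_def Suc)
      have xz: "x < z" using less.IH[of k] Suc by (simp add: z_def)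
      have zI: "z \<in> {a..b}" unfolding z_def by (rule iterate_in[OF f x(1)])
      have cont: "continuous_on {a..b} f" using f by (auto simp: F1_def)
      define S where "S = {u \<in> {x..z}. f u - u = 0}"
      have "closed S" unfolding S_def
        using x zI by (intro continuous_closed_preimage_constant continuous_intros
            continuous_on_subset[OF cont]) auto
      moreover have "\<exists>u. x \<le> u \<and> u \<le> z \<and> f u - u = 0"
        using x xz zI fz by (intro IVT2' continuous_intros continuous_on_subset[OF cont]) auto
      then have "S \<noteq> {}" unfolding S_def by auto
      moreover have ba: "bdd_above S" unfolding S_def by (auto intro!: bdd_aboveI)
      ultimately have "Sup S \<in> S" by (intro closed_contains_Sup)
      define q where "q = Sup S"
      have q: "x \<le> q" "q \<le> z" "f q = q" using \<open>Sup S \<in> S\<close> unfolding q_def S_def by auto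
      have last: "u \<le> q" if "x \<le> u" "u \<le> z" "f u = u" for u
        unfolding q_def using that by (intro cSup_upper ba) (auto simp: S_def)
      have "q < z" using q fz xz by (cases "q = z") auto
      have above: "f u < u" if "q < u" "u \<le> z" for u
      proof (rule ccontr)
        assume "\<not> f u < u"
        then have "\<exists>r. u \<le> r \<and> r \<le> z \<and> f r - r = 0"
          using that x q xz fz zI
          by (intro IVT2' continuous_intros continuous_on_subset[OF cont]) auto
        then obtain r where "u \<le> r" "r \<le> z" "f r = r" by auto
        then show False using last[of r] that q by simp
      qed
      \<comment> \<open>Beyond \<open>q\<close> points move down. A point \<open>w \<le> q\<close>
        is the image of some \<open>y\<close> in \<open>[q,z]\<close>, as \<open>f\<close> runs from
        \<open>q\<close> down to at most \<open>x\<close> there; if \<open>y > q\<close>, then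
        \<open>y\<close> moves down to \<open>w\<close>, and \<open>down_step_down\<close> bounds
        \<open>f w\<close> by \<open>y\<close>.\<close>
      have stay: "f w < z" if w: "x \<le> w" "w < z" for w
      proof (cases "q < w")
        case True
        then show ?thesis using above[of w] w by simp
      next
        case False
        have "\<exists>y. q \<le> y \<and> y \<le> z \<and> f y = w"
          using False w q fz x zI by (intro IVT2' continuous_on_subset[OF cont]) auto
        then obtain y where y: "q \<le> y" "y \<le> z" "f y = w" by blast
        show ?thesis
        proof (cases "y = q")
          case True
          then show ?thesis using y q \<open>q < z\<close> by simp
        next
          case False
          then have "f y < y" using above[of y] y by simp
          with down_step_down[OF f, of y] y q x zI show ?thesis by auto
        qed
      qed
      have "i \<le> Suc k \<Longrightarrow> (f ^^ i) x < z" for i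
      proof (induction i)
        case 0
        then show ?case using xz by simp
      next
        case (Suc i)
        then show ?case using stay[OF prev[of i]] by simp
      qed
      then show False unfolding z_def by blast
    qed
  qed
qed

text \<open>Mirror image of \<open>iterates_above\<close>, by conjugation with
  \<open>x \<mapsto> -x\<close>.\<close>

lemma iterates_below:
  fixes f :: "real \<Rightarrow> real"
  assumes f: "f \<in> F1 {a..b}" and x: "x \<in> {a..b}" "f x < x"
  shows "(f ^^ Suc k) x < x"
proof -
  define h where "h = (\<lambda>x. - f (- x))"
  have cont: "continuous_on {a..b} f" and maps: "\<And>x. x \<in> {a..b} \<Longrightarrow> f x \<in> {a..b}"
    and nocyc: "\<not> admits_2_cycle {a..b} f"
    using f unfolding F1_def by auto
  have "continuous_on {-b..-a} h"
    unfolding h_def by (intro continuous_intros continuous_on_compose2[OF cont]) auto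
  moreover have "h \<in> {-b..-a} \<rightarrow> {-b..-a}"
    unfolding h_def using maps[of "- x" for x] by force
  moreover have "\<not> admits_2_cycle {-b..-a} h"
  proof
    assume "admits_2_cycle {-b..-a} h"
    then obtain u v where "u \<in> {-b..-a}" "v \<in> {-b..-a}" "u \<noteq> v" "h u = v" "h v = u"
      unfolding admits_2_cycle_def by blast
    then have "- u \<in> {a..b}" "- v \<in> {a..b}" "- u \<noteq> - v" "f (- u) = - v" "f (- v) = - u"
      unfolding h_def by auto
    then show False using nocyc unfolding admits_2_cycle_def by blast
  qed
  ultimately have "h \<in> F1 {-b..-a}" by (simp add: F1_def)
  moreover have "(h ^^ n) (- x) = - (f ^^ n) x" for n
    by (induction n) (auto simp: h_def)
  ultimately show ?thesis
    using iterates_above[of h "-b" "-a" "- x" k] x by (simp add: h_def)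
qed

text \<open>The first step from the \<open>m\<close>-th point decides the side of all later points:
  apply \<open>iterates_above\<close> or \<open>iterates_below\<close> from there, or note that the
  orbit is constant. Comparisons between any two times thus reduce to single steps.\<close>

lemma sgn_orbit_diff:
  fixes f :: "real \<Rightarrow> real"
  assumes f: "f \<in> F1 {a..b}" and x: "x \<in> {a..b}" and "m < n"
  shows "sgn ((f ^^ n) x - (f ^^ m) x) = sgn ((f ^^ Suc m) x - (f ^^ m) x)"
proof -
  define u where "u = (f ^^ m) x"
  obtain k where k: "n = Suc k + m" using \<open>m < n\<close> less_iff_Suc_add by fastforce
  have u: "u \<in> {a..b}" unfolding u_def by (rule iterate_in[OF f x])
  have eq: "(f ^^ n) x = (f ^^ Suc k) u"
    unfolding k u_def by (simp only: funpow_add o_apply)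
  consider "f u = u" | "u < f u" | "f u < u" by linarith
  then have "sgn ((f ^^ Suc k) u - u) = sgn (f u - u)"
  proof cases
    case 1
    then have "(f ^^ i) u = u" for i by (induction i) auto
    then show ?thesis using 1 by metis
  next
    case 2
    then show ?thesis using iterates_above[OF f u, of k] by simp
  next
    case 3
    then show ?thesis using iterates_below[OF f u, of k] by simp
  qed
  then show ?thesis unfolding eq by (simp add: u_def)
qed

lemma same_step_signs_imp_same_order_pattern:
  fixes f g :: "real \<Rightarrow> real"
  assumes f: "f \<in> F1 {a..b}" "x \<in> {a..b}" and g: "g \<in> F1 {c..d}" "y \<in> {c..d}"
    and eq: "\<And>n. sgn ((f ^^ Suc n) x - (f ^^ n) x) = sgn ((g ^^ Suc n) y - (g ^^ n) y)"
  shows "same_order_pattern (\<lambda>n. (f ^^ n) x) (\<lambda>n. (g ^^ n) y)"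
  unfolding same_order_pattern_def
proof (intro allI)
  fix m n :: nat
  have *: "sgn ((f ^^ j) x - (f ^^ i) x) = sgn ((g ^^ j) y - (g ^^ i) y)" if "i < j" for i j
    using sgn_orbit_diff[OF f that] sgn_orbit_diff[OF g that] eq[of i] by simp
  show "(f ^^ m) x < (f ^^ n) x \<longleftrightarrow> (g ^^ m) y < (g ^^ n) y"
  proof (cases m n rule: linorder_cases)
    case less
    from *[OF this] show ?thesis by (auto simp: sgn_if split: if_splits)
  next
    case greater
    from *[OF this] show ?thesis by (auto simp: sgn_if split: if_splits)
  qed simp
qed

section \<open>Realising sign sequences near a swinging fixed point\<close>

text \<open>The sets \<open>K n\<close> of points obeying the first constraints, up to time
  \<open>n\<close>, are compact and decreasing. Each is nonempty because a point of
  \<open>A n\<close> can be pulled back through the coverings to \<open>A 0\<close>. A common point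
  has the full itinerary.\<close>

lemma itinerary_exists:
  fixes f :: "'a::heine_borel \<Rightarrow> 'a"
  assumes cont: "continuous_on I f" and maps: "f ` I \<subseteq> I"
    and comp: "\<And>n. compact (A n)" and sub: "\<And>n. A n \<subseteq> I" and ne: "\<And>n. A n \<noteq> {}"
    and cover: "\<And>n. A (Suc n) \<subseteq> f ` A n"
  shows "\<exists>x. \<forall>n. (f ^^ n) x \<in> A n"
proof -
  define K where "K n = {x \<in> A 0. \<forall>i\<le>n. (f ^^ i) x \<in> A i}" for n
  have iter: "continuous_on I (f ^^ i) \<and> (f ^^ i) ` I \<subseteq> I" for i
  proof (induction i)
    case (Suc i)
    then have "continuous_on I (\<lambda>x. f ((f ^^ i) x))"
      by (intro continuous_on_compose2[OF cont]) auto
    with Suc maps show ?case by (auto simp: o_def)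
  qed (auto simp: id_def)
  have "compact (K n)" for n
  proof -
    have "closedin (top_of_set (A 0)) (A 0 \<inter> (f ^^ i) -` A i)" for i
      using comp[of i] iter[of i] sub[of 0]
      by (intro continuous_closedin_preimage)
         (auto intro: continuous_on_subset compact_imp_closed)
    then have "closedin (top_of_set (A 0)) (\<Inter>i\<in>{..n}. A 0 \<inter> (f ^^ i) -` A i)"
      by (intro closedin_INT) auto
    then have "compact (\<Inter>i\<in>{..n}. A 0 \<inter> (f ^^ i) -` A i)"
      using comp[of 0] closedin_compact by blast
    moreover have "K n = (\<Inter>i\<in>{..n}. A 0 \<inter> (f ^^ i) -` A i)" unfolding K_def by auto
    ultimately show ?thesis by simp
  qed
  moreover have "K n \<noteq> {}" for n
  proof -
    have "\<exists>x. (f ^^ n) x = y \<and> (\<forall>i\<le>n. (f ^^ i) x \<in> A i)" if "y \<in> A n" for y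
      using that
    proof (induction n arbitrary: y)
      case 0
      then show ?case by auto
    next
      case (Suc n)
      then obtain z where z: "z \<in> A n" "y = f z" using cover[of n] by auto
      with Suc.IH[of z] Suc.prems show ?case by (auto simp: le_Suc_eq)
    qed
    then show ?thesis using ne[of n] unfolding K_def by fastforce
  qed
  moreover have "K n \<subseteq> K m" if "m \<le> n" for m n using that unfolding K_def by auto
  ultimately have "\<Inter>(range K) \<noteq> {}" by (intro compact_nest) auto
  then show ?thesis unfolding K_def by auto
qed

text \<open>The signs \<open>s\<close> and \<open>t\<close> select the side of \<open>p\<close> on which a point and its image lie;
  \<open>1\<close> stands for below \<open>p\<close>, the side where orbits have to step upwards.\<close>

definition swings_at :: "real set \<Rightarrow> (real \<Rightarrow> real) \<Rightarrow> real \<Rightarrow> bool" where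
  "swings_at I f p \<longleftrightarrow> (\<forall>e>0. \<forall>s\<in>{-1,1}. \<forall>t\<in>{-1,1}.
     \<exists>x\<in>I. \<bar>x - p\<bar> < e \<and> sgn (p - x) = s \<and> sgn (p - f x) = t)"

text \<open>The set \<open>f > 0\<close> is open in \<open>S\<close>, nonempty and not all of
  \<open>S\<close>, so connectedness prevents it from being closed. A limit point \<open>w\<close>
  that it misses has \<open>f w \<le> 0\<close>, and continuity excludes
  \<open>f w < 0\<close>.\<close>

lemma boundary_of_superlevel:
  fixes f :: "real \<Rightarrow> real"
  assumes S: "connected S" and cont: "continuous_on S f"
    and y: "y \<in> S" "f y \<le> 0" and z: "z \<in> S" "f z > 0"
  shows "\<exists>w\<in>S. f w = 0 \<and> (\<forall>r>0. \<exists>x\<in>S. \<bar>x - w\<bar> < r \<and> f x > 0)"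
proof -
  define T where "T = {x \<in> S. f x > 0}"
  have "T = S \<inter> f -` {0<..}" unfolding T_def by auto
  then have "openin (top_of_set S) T"
    using continuous_openin_preimage_gen[OF cont, of "{0<..}"] by simp
  moreover have "z \<in> T" "y \<notin> T" using y z unfolding T_def by auto
  ultimately have "\<not> closedin (top_of_set S) T" using S y(1) unfolding connected_clopen by blast
  then obtain w where w: "w islimpt T" "w \<in> S" "w \<notin> T"
    unfolding closedin_limpt by (auto simp: T_def)
  have near: "\<exists>x\<in>S. \<bar>x - w\<bar> < r \<and> f x > 0" if "r > 0" for r
    using w(1) that unfolding islimpt_approachable T_def by (auto simp: dist_real_def)
  have "f w = 0"
  proof (rule ccontr)
    assume "f w \<noteq> 0"
    then have "f w < 0" using w unfolding T_def by auto
    then obtain r where r: "r > 0" "\<And>x. x \<in> S \<Longrightarrow> dist x w < r \<Longrightarrow> dist (f x) (f w) < - f w"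
      using cont w(2) unfolding continuous_on_iff by (meson neg_0_less_iff_less)
    obtain x where "x \<in> S" "\<bar>x - w\<bar> < r" "f x > 0" using near[OF r(1)] by blast
    with r(2)[of x] show False by (auto simp: dist_real_def)
  qed
  with near w(2) show ?thesis by blast
qed

text \<open>A point \<open>w\<close> on side \<open>s\<close> with \<open>f w = p\<close> steps
  towards \<open>p\<close>, and so do all points of that side close to it. With \<open>w\<close> on
  the boundary of the set sent to side \<open>t\<close>, a short segment from \<open>w\<close> to a
  point \<open>v\<close> of that set has an image reaching from \<open>p\<close> to
  \<open>f v\<close>, which covers a one-sided neighbourhood of \<open>p\<close>.\<close>

lemma covering_interval:
  fixes f :: "real \<Rightarrow> real"
  assumes cont: "continuous_on {a..b} f" and p: "p \<in> {a..b}" "f p = p"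
    and sw: "swings_at {a..b} f p" and e: "e > 0"
    and s: "s \<in> {-1,0,1}" and t: "t \<in> {-1,0,1}" and st: "s = 0 \<longrightarrow> t = 0"
  shows "\<exists>A d. compact A \<and> A \<noteq> {} \<and> d > 0 \<and>
    A \<subseteq> {x \<in> {a..b}. \<bar>x - p\<bar> < e \<and> sgn (p - x) = s \<and> sgn (f x - x) = s} \<and>
    {y. \<bar>y - p\<bar> < d \<and> sgn (p - y) = t} \<subseteq> f ` A"
proof (cases "s = 0")
  case True
  then show ?thesis using st p e
    by (intro exI[of _ "{p}"] exI[of _ 1]) (auto simp: sgn_0_0)
next
  case False
  then have s: "s \<in> {-1,1}" using s by auto
  define S where "S = {x \<in> {a..b}. \<bar>x - p\<bar> < e \<and> sgn (p - x) = s}"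
  have S_eq: "S = {a..b} \<inter> {p - e<..<p + e} \<inter> (if s = 1 then {..<p} else {p<..})"
    using s unfolding S_def by (auto simp: sgn_if split: if_splits)
  have conv: "convex S" unfolding S_eq by (auto intro!: convex_Int)
  have contS: "continuous_on S f" by (rule continuous_on_subset[OF cont]) (auto simp: S_def)
  \<comment> \<open>For \<open>t = 0\<close> only \<open>p\<close> has to be covered, and
    \<open>f w = p\<close> achieves this; the side \<open>1\<close> is then an arbitrary
    choice.\<close>
  define c :: real where "c = (if t = 0 then 1 else t)"
  have c: "c \<in> {-1,1}" using t unfolding c_def by auto
  have ex: "\<exists>x\<in>S. sgn (p - f x) = u" if "u \<in> {-1,1}" for u
    using sw e s that unfolding swings_at_def S_def by blast
  obtain z where z: "z \<in> S" "c * (p - f z) > 0"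
    using ex[of c] c by (auto simp: sgn_if split: if_splits)
  obtain y where y: "y \<in> S" "c * (p - f y) \<le> 0"
    using ex[of "-c"] c by (auto simp: sgn_if split: if_splits)
  have "\<exists>w\<in>S. c * (p - f w) = 0 \<and> (\<forall>r>0. \<exists>x\<in>S. \<bar>x - w\<bar> < r \<and> c * (p - f x) > 0)"
    using y z by (intro boundary_of_superlevel convex_connected[OF conv] continuous_intros contS)
  then obtain w where w: "w \<in> S" "f w = p"
    and near: "\<And>r. r > 0 \<Longrightarrow> \<exists>x\<in>S. \<bar>x - w\<bar> < r \<and> c * (p - f x) > 0"
    using c by auto
  have "continuous_on S (\<lambda>x. s * (f x - x))" by (intro continuous_intros contS)
  moreover have pos: "s * (f w - w) > 0"
    using w s unfolding S_def by (auto simp: sgn_if split: if_splits)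
  ultimately obtain r where r: "r > 0"
    "\<And>x. x \<in> S \<Longrightarrow> dist x w < r \<Longrightarrow> dist (s * (f x - x)) (s * (f w - w)) < s * (f w - w)"
    using w(1) unfolding continuous_on_iff by meson
  have step: "sgn (f x - x) = s" if "x \<in> S" "\<bar>x - w\<bar> < r" for x
    using r(2)[of x] that pos s by (auto simp: dist_real_def sgn_if abs_if split: if_splits)
  obtain v where v: "v \<in> S" "\<bar>v - w\<bar> < r" "c * (p - f v) > 0" using near[OF r(1)] by blast
  define A where "A = closed_segment w v"
  have "A \<subseteq> S" unfolding A_def using v w conv by (simp add: closed_segment_subset)
  moreover have "\<bar>x - w\<bar> < r" if "x \<in> A" for x
    using that v r unfolding A_def closed_segment_eq_real_ivl by (auto split: if_splits)
  ultimately have A: "A \<subseteq> {x \<in> {a..b}. \<bar>x - p\<bar> < e \<and> sgn (p - x) = s \<and> sgn (f x - x) = s}"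
    using step unfolding S_def by blast
  have "connected (f ` A)"
    unfolding A_def
    by (intro connected_continuous_image continuous_on_subset[OF contS])
       (use \<open>A \<subseteq> S\<close> A_def in auto)
  moreover have "p \<in> f ` A" "f v \<in> f ` A" unfolding A_def using w by (auto intro: rev_image_eqI)
  ultimately have seg: "closed_segment p (f v) \<subseteq> f ` A"
    by (metis closed_segment_subset connected_convex_1)
  have "y \<in> closed_segment p (f v)" if "\<bar>y - p\<bar> < \<bar>f v - p\<bar>" "sgn (p - y) = t" for y
    using that v(3) c unfolding c_def closed_segment_eq_real_ivl
    by (auto simp: sgn_if split: if_splits)
  with seg have "{y. \<bar>y - p\<bar> < \<bar>f v - p\<bar> \<and> sgn (p - y) = t} \<subseteq> f ` A" by blast
  moreover have "\<bar>f v - p\<bar> > 0" using v(3) by auto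
  moreover have "compact A" "A \<noteq> {}" unfolding A_def by auto
  ultimately show ?thesis using A by blast
qed

text \<open>Chains covering intervals. The condition \<open>stop\<close> holds for every orbit: a
  zero step means a fixed point, after which all steps are zero.\<close>

lemma swings_realise_signs:
  fixes f :: "real \<Rightarrow> real" and s :: "nat \<Rightarrow> real"
  assumes f: "f \<in> F1 {a..b}" and p: "p \<in> {a..b}" "f p = p" and sw: "swings_at {a..b} f p"
    and s: "\<And>n. s n \<in> {-1,0,1}" and stop: "\<And>n. s n = 0 \<Longrightarrow> s (Suc n) = 0"
  shows "\<exists>x\<in>{a..b}. \<forall>n. sgn ((f ^^ Suc n) x - (f ^^ n) x) = s n"
proof -
  have cont: "continuous_on {a..b} f" and maps: "f ` {a..b} \<subseteq> {a..b}"
    using f unfolding F1_def by auto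
  let ?P = "\<lambda>n e A d. compact A \<and> A \<noteq> {} \<and> d > 0 \<and>
    A \<subseteq> {x \<in> {a..b}. \<bar>x - p\<bar> < e \<and> sgn (p - x) = s n \<and> sgn (f x - x) = s n} \<and>
    {y. \<bar>y - p\<bar> < d \<and> sgn (p - y) = s (Suc n)} \<subseteq> f ` A"
  have "\<forall>n e. \<exists>Ad. e > 0 \<longrightarrow> ?P n e (fst Ad) (snd Ad)"
  proof (intro allI)
    fix n and e :: real
    have "\<exists>A d. ?P n e A d" if "e > 0"
      by (rule covering_interval[OF cont p sw that s s]) (use stop in blast)
    then show "\<exists>Ad. e > 0 \<longrightarrow> ?P n e (fst Ad) (snd Ad)"
      by (simp only: split_paired_Ex fst_conv snd_conv) blast
  qed
  then obtain Ad where Ad: "\<And>n e. e > 0 \<Longrightarrow> ?P n e (fst (Ad n e)) (snd (Ad n e))"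
    by (auto simp only: choice_iff)
  \<comment> \<open>The radius covered by one image becomes the closeness to \<open>p\<close>
    demanded of the next interval, so \<open>B (Suc n)\<close> lies in the image of
    \<open>B n\<close>.\<close>
  define e where "e = rec_nat 1 (\<lambda>n e. snd (Ad n e))"
  have e_Suc: "e (Suc n) = snd (Ad n (e n))" for n unfolding e_def by simp
  have e_pos: "e n > 0" for n
  proof (induction n)
    case 0
    then show ?case by (simp add: e_def)
  next
    case (Suc n)
    then show ?case using Ad[of "e n" n] e_Suc by simp
  qed
  define B where "B n = fst (Ad n (e n))" for n
  have B: "?P n (e n) (B n) (e (Suc n))" for n
    unfolding B_def e_Suc by (rule Ad[OF e_pos])
  have "B (Suc n) \<subseteq> f ` B n" for n using B[of n] B[of "Suc n"] by blast
  moreover have "B n \<subseteq> {a..b}" "compact (B n)" "B n \<noteq> {}" for n using B[of n] by auto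
  ultimately obtain x where x: "\<And>n. (f ^^ n) x \<in> B n"
    using itinerary_exists[OF cont maps, of B] by blast
  have "sgn ((f ^^ Suc n) x - (f ^^ n) x) = s n" for n
    using x[of n] B[of n] by auto
  moreover have "x \<in> {a..b}" using x[of 0] B[of 0] by auto
  ultimately show ?thesis by blast
qed

lemma swings_imp_universal:
  fixes f :: "real \<Rightarrow> real"
  assumes f: "f \<in> F1 {a..b}" and p: "p \<in> {a..b}" "f p = p" and sw: "swings_at {a..b} f p"
  shows "universal_in {a..b} (F1 {a..b}) f"
  unfolding universal_in_def
proof (intro ballI)
  fix g y assume g: "g \<in> F1 {a..b}" "y \<in> {a..b}"
  let ?s = "\<lambda>n. sgn ((g ^^ Suc n) y - (g ^^ n) y)"
  have "\<exists>x\<in>{a..b}. \<forall>n. sgn ((f ^^ Suc n) x - (f ^^ n) x) = ?s n"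
    by (rule swings_realise_signs[OF f p sw]) (simp add: sgn_if, simp add: sgn_eq_0_iff)
  then obtain x where "x \<in> {a..b}" "\<And>n. sgn ((f ^^ Suc n) x - (f ^^ n) x) = ?s n" by blast
  then show "\<exists>x\<in>{a..b}. same_order_pattern (\<lambda>n. (f ^^ n) x) (\<lambda>n. (g ^^ n) y)"
    using same_step_signs_imp_same_order_pattern[OF f _ g] by blast
qed

section \<open>Universality forces swings\<close>

text \<open>Supplies a member of \<open>F1\<close> to test universality against: a copy of
  \<open>x * sin (1 / x) / 2\<close> centred at the midpoint. The factor 1/2 makes distances to
  \<open>c\<close> at least halve, which yields continuity at \<open>c\<close>, invariance of the
  interval and absence of 2-cycles at once.\<close>

lemma exists_swinging_map:
  fixes a b :: real
  assumes "a < b"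
  shows "\<exists>g c. g \<in> F1 {a..b} \<and> c \<in> {a..b} \<and> g c = c \<and> swings_at {a..b} g c"
proof -
  define c where "c = (a + b) / 2"
  define g where "g x = c + (x - c) / 2 * sin (1 / (x - c))" for x
  have contr: "\<bar>g x - c\<bar> \<le> \<bar>x - c\<bar> / 2" for x
    using mult_left_le[of "\<bar>sin (1 / (x - c))\<bar>" "\<bar>x - c\<bar> / 2"]
    by (simp add: g_def abs_mult)
  have gc: "g c = c" by (simp add: g_def)
  have "isCont g x" for x
  proof (cases "x = c")
    case False
    then show ?thesis unfolding g_def by (intro continuous_intros) auto
  next
    case True
    have "((\<lambda>x. \<bar>x - c\<bar> / 2) \<longlongrightarrow> 0) (at c)"
      by (auto intro!: tendsto_eq_intros)
    then have "((\<lambda>x. g x - c) \<longlongrightarrow> 0) (at c)"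
      by (rule Lim_null_comparison[rotated]) (use contr in auto)
    then show ?thesis using True gc unfolding isCont_def by (simp add: LIM_zero_iff)
  qed
  then have "continuous_on {a..b} g" by (simp add: continuous_at_imp_continuous_on)
  moreover have "g \<in> {a..b} \<rightarrow> {a..b}"
  proof
    fix x assume "x \<in> {a..b}"
    then show "g x \<in> {a..b}"
      using contr[of x] by (auto simp: c_def abs_if field_simps split: if_splits)
  qed
  moreover have "\<not> admits_2_cycle {a..b} g"
  proof
    assume "admits_2_cycle {a..b} g"
    then obtain u v where "u \<noteq> v" "g u = v" "g v = u" unfolding admits_2_cycle_def by blast
    then have "\<bar>v - c\<bar> \<le> \<bar>u - c\<bar> / 2" "\<bar>u - c\<bar> \<le> \<bar>v - c\<bar> / 2"
      using contr[of u] contr[of v] by simp_all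
    moreover have "A = 0" if "0 \<le> A" "0 \<le> B" "A \<le> B / 2" "B \<le> A / 2" for A B :: real
      using that by linarith
    ultimately have "\<bar>u - c\<bar> = 0" "\<bar>v - c\<bar> = 0" by (meson abs_ge_zero)+
    with \<open>u \<noteq> v\<close> show False by simp
  qed
  moreover have "swings_at {a..b} g c"
    unfolding swings_at_def
  proof (intro allI impI ballI)
    fix e s t :: real assume e: "e > 0" and s: "s \<in> {-1,1}" and t: "t \<in> {-1,1}"
    \<comment> \<open>The second bound keeps \<open>x\<close> inside the interval.\<close>
    define r where "r = min e ((b - a) / 2)"
    have "r > 0" using e assms by (simp add: r_def)
    then obtain n where n: "n \<noteq> 0" "inverse (real n) < r" using real_arch_inverse[of r] by auto
    \<comment> \<open>Chosen so that \<open>sin k = -t\<close>; with \<open>x = c - s / k\<close>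
      this gives \<open>c - g x = t / (2 * k)\<close>. Moreover \<open>k > n\<close>, so
      \<open>x\<close> is within \<open>r\<close> of \<open>c\<close>.\<close>
    define k where "k = 2 * real n * pi - t * (pi / 2)"
    have "real n * 1 \<le> real n * pi" using pi_gt3 by (intro mult_left_mono) auto
    moreover have "1 * pi \<le> real n * pi" using n pi_gt3 by (intro mult_right_mono) auto
    moreover have "t * (pi / 2) \<le> pi / 2" using t by auto
    ultimately have k: "real n < k" unfolding k_def using pi_gt3 by linarith
    have "k > 0" using k by linarith
    have "inverse k < r"
      using k n le_imp_inverse_le[of "real n" k] by linarith
    have "sin (t * (pi / 2)) = t" "cos (t * (pi / 2)) = 0" using t by auto
    then have sink: "sin k = - t" unfolding k_def by (simp add: sin_diff)
    define x where "x = c - s * inverse k"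
    have ss: "s * s = 1" using s by auto
    have "1 / (x - c) = - s * k" using s \<open>k > 0\<close> by (auto simp: x_def field_simps)
    then have "sin (1 / (x - c)) = s * t" using s sink by auto
    then have "c - g x = t * inverse k / 2" using s by (auto simp: g_def x_def)
    then have "sgn (c - g x) = sgn (t * inverse k / 2)" by (rule arg_cong)
    then have "sgn (c - g x) = t" using t \<open>k > 0\<close> by (auto simp: sgn_mult)
    moreover have "sgn (c - x) = s" using s \<open>k > 0\<close> by (auto simp: x_def sgn_mult)
    moreover have "\<bar>x - c\<bar> = inverse k" using s \<open>k > 0\<close> by (auto simp: x_def)
    then have "\<bar>x - c\<bar> < r" using \<open>inverse k < r\<close> by simp
    then have "\<bar>x - c\<bar> < e" "x \<in> {a..b}"
      by (auto simp: r_def c_def abs_if field_simps split: if_splits)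
    ultimately show "\<exists>x\<in>{a..b}. \<bar>x - c\<bar> < e \<and> sgn (c - x) = s \<and> sgn (c - g x) = t"
      by blast
  qed
  moreover have "c \<in> {a..b}" using assms by (simp add: c_def)
  ultimately show ?thesis using gc unfolding F1_def by blast
qed

lemma universal_imp_swings:
  fixes f :: "real \<Rightarrow> real"
  assumes "a < b" and f: "f \<in> F1 {a..b}" and univ: "universal_in {a..b} (F1 {a..b}) f"
  shows "\<exists>p\<in>{a..b}. f p = p \<and> swings_at {a..b} f p"
proof -
  \<comment> \<open>Up, up, down, down: cyclically, every pair of signs occurs as two consecutive
    terms.\<close>
  define s :: "nat \<Rightarrow> real" where "s n = (if n mod 4 < 2 then 1 else -1)" for n
  obtain g c where g: "g \<in> F1 {a..b}" and c: "c \<in> {a..b}" "g c = c" "swings_at {a..b} g c"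
    using exists_swinging_map[OF \<open>a < b\<close>] by blast
  have "\<exists>y\<in>{a..b}. \<forall>n. sgn ((g ^^ Suc n) y - (g ^^ n) y) = s n"
    by (rule swings_realise_signs[OF g c]) (auto simp: s_def split: if_splits)
  then obtain y where y: "y \<in> {a..b}" "\<And>n. sgn ((g ^^ Suc n) y - (g ^^ n) y) = s n" by blast
  obtain x where x: "x \<in> {a..b}" "same_order_pattern (\<lambda>n. (f ^^ n) x) (\<lambda>n. (g ^^ n) y)"
    using univ g y(1) unfolding universal_in_def by blast
  define X where "X n = (f ^^ n) x" for n
  have XI: "X n \<in> {a..b}" for n unfolding X_def by (rule iterate_in[OF f x(1)])
  have fX: "f (X n) = X (Suc n)" for n by (simp add: X_def)
  have gs: "sgn ((g ^^ n) y - (g ^^ m) y) = s m" if "m < n" for m n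
    using sgn_orbit_diff[OF g y(1) that] y(2) by simp
  have up: "X m < X n" if "m < n" "m mod 4 < 2" for m n
  proof -
    have "(g ^^ m) y < (g ^^ n) y" using gs[OF that(1)] that(2) by (simp add: s_def sgn_1_pos)
    then show ?thesis using x(2) unfolding same_order_pattern_def X_def by blast
  qed
  have down: "X n < X m" if "m < n" "\<not> m mod 4 < 2" for m n
  proof -
    have "(g ^^ n) y < (g ^^ m) y" using gs[OF that(1)] that(2) by (simp add: s_def sgn_1_neg)
    then show ?thesis using x(2) unfolding same_order_pattern_def X_def by blast
  qed
  \<comment> \<open>Each \<open>X (4 * k)\<close> is an up-point, hence below everything later;
    dually for the down-points \<open>X (4 * k + 2)\<close>. The remaining residues are squeezed
    between these.\<close>
  have "incseq (\<lambda>k. X (4 * k))" by (intro incseq_SucI less_imp_le up) auto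
  then obtain u where u: "(\<lambda>k. X (4 * k)) \<longlonglongrightarrow> u" "\<And>k. X (4 * k) \<le> u"
    using XI by (auto intro: incseq_convergent[of _ b])
  have "decseq (\<lambda>k. X (4 * k + 2))" by (intro decseq_SucI less_imp_le down) (auto simp: mod_Suc)
  then obtain v where v: "(\<lambda>k. X (4 * k + 2)) \<longlonglongrightarrow> v" "\<And>k. v \<le> X (4 * k + 2)"
    using XI by (auto intro: decseq_convergent[of _ a])
  have u1: "(\<lambda>k. X (4 * k + 1)) \<longlonglongrightarrow> u"
  proof (rule tendsto_sandwich[OF _ _ u(1) LIMSEQ_Suc[OF u(1)]])
    show "eventually (\<lambda>k. X (4 * k) \<le> X (4 * k + 1)) sequentially"
      by (intro always_eventually allI less_imp_le up) auto
    show "eventually (\<lambda>k. X (4 * k + 1) \<le> X (4 * Suc k)) sequentially"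
      by (intro always_eventually allI less_imp_le up) (auto simp: mod_Suc)
  qed
  have v1: "(\<lambda>k. X (4 * k + 3)) \<longlonglongrightarrow> v"
  proof (rule tendsto_sandwich[OF _ _ LIMSEQ_Suc[OF v(1)] v(1)])
    show "eventually (\<lambda>k. X (4 * k + 3) \<le> X (4 * k + 2)) sequentially"
      by (intro always_eventually allI less_imp_le down) (auto simp: mod_Suc)
    show "eventually (\<lambda>k. X (4 * Suc k + 2) \<le> X (4 * k + 3)) sequentially"
      by (intro always_eventually allI less_imp_le down) (auto simp: mod_Suc)
  qed
  have uI: "u \<in> {a..b}" using closed_sequentially[OF closed_atLeastAtMost _ u(1)] XI by blast
  have cont: "continuous_on {a..b} f" using f by (simp add: F1_def)
  have flim: "(\<lambda>k. f (X (h k))) \<longlonglongrightarrow> f u" if "(\<lambda>k. X (h k)) \<longlonglongrightarrow> u" for h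
    by (rule continuous_on_tendsto_compose[OF cont that uI]) (simp add: XI del: atLeastAtMost_iff)
  \<comment> \<open>\<open>f\<close> takes \<open>X (4 * k)\<close> to \<open>X (4 * k + 1)\<close>,
    both tending to \<open>u\<close>, and \<open>X (4 * k + 1)\<close> to
    \<open>X (4 * k + 2)\<close>, which tends to \<open>v\<close>.\<close>
  have "f u = u" using flim[OF u(1)] u1 unfolding fX by (auto intro: LIMSEQ_unique)
  moreover have "f u = v" using flim[OF u1] v(1) unfolding fX by (auto intro: LIMSEQ_unique)
  ultimately have "v = u" by simp
  have lim: "(\<lambda>k. X (4 * k + r)) \<longlonglongrightarrow> u" if "r < 4" for r
  proof -
    have "r \<in> {0,1,2,3}" using that by auto
    then show ?thesis using u(1) u1 v(1) v1 \<open>v = u\<close> by auto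
  qed
  \<comment> \<open>A later point of the same kind lies strictly between \<open>X n\<close> and the
    common limit or at the limit, so \<open>X n\<close> itself is strictly off it.\<close>
  have side: "sgn (u - X n) = s n" for n
  proof (cases "n mod 4 < 2")
    case True
    then show ?thesis using up[of n "4 * Suc n"] u(2)[of "Suc n"] by (simp add: s_def sgn_1_pos)
  next
    case False
    then show ?thesis using down[of n "4 * Suc n + 2"] v(2)[of "Suc n"] \<open>v = u\<close>
      by (simp add: s_def sgn_1_neg)
  qed
  have "swings_at {a..b} f u"
    unfolding swings_at_def
  proof (intro allI impI ballI)
    fix e \<sigma> \<tau> :: real assume e: "e > 0" and \<sigma>: "\<sigma> \<in> {-1,1}" and \<tau>: "\<tau> \<in> {-1,1}"
    \<comment> \<open>The residue at which the sign is \<open>\<sigma>\<close> and the next one is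
      \<open>\<tau>\<close>; by \<open>side\<close> these are the sides of \<open>X n\<close> and of
      its image.\<close>
    define r :: nat where "r = (if \<sigma> = 1 then if \<tau> = 1 then 0 else 1 else if \<tau> = 1 then 3 else 2)"
    have r: "r < 4" "s (4 * k + r) = \<sigma>" "s (Suc (4 * k + r)) = \<tau>" for k
      using \<sigma> \<tau> by (auto simp: r_def s_def mod_Suc)
    obtain k where "\<bar>X (4 * k + r) - u\<bar> < e"
      using LIMSEQ_D[OF lim[OF r(1)] e] by auto
    then show "\<exists>x\<in>{a..b}. \<bar>x - u\<bar> < e \<and> sgn (u - x) = \<sigma> \<and> sgn (u - f x) = \<tau>"
      using XI[of "4 * k + r"] side r(2,3) fX by (intro bexI[of _ "X (4 * k + r)"]) auto
  qed
  with uI \<open>f u = u\<close> show ?thesis by blast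
qed

lemma swings_at_iff:
  "swings_at I f p \<longleftrightarrow>
    (\<forall>\<epsilon>>0. \<exists>x1 \<in> I \<inter> {p<..<p + \<epsilon>}. \<exists>x2 \<in> I \<inter> {p<..<p + \<epsilon>}.
            \<exists>x3 \<in> I \<inter> {p - \<epsilon><..<p}. \<exists>x4 \<in> I \<inter> {p - \<epsilon><..<p}.
              f x1 > p \<and> f x2 < p \<and> f x3 > p \<and> f x4 < p)"
proof -
  have "\<bar>x - p\<bar> < e \<and> sgn (p - x) = -1 \<longleftrightarrow> x \<in> {p<..<p + e}"
    and "\<bar>x - p\<bar> < e \<and> sgn (p - x) = 1 \<longleftrightarrow> x \<in> {p - e<..<p}" for x e
    by (auto simp: sgn_1_neg sgn_1_pos)
  then have "(\<exists>x\<in>I. \<bar>x - p\<bar> < e \<and> sgn (p - x) = -1 \<and> P x) \<longleftrightarrow> (\<exists>x\<in>I \<inter> {p<..<p + e}. P x)"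
    and "(\<exists>x\<in>I. \<bar>x - p\<bar> < e \<and> sgn (p - x) = 1 \<and> P x) \<longleftrightarrow> (\<exists>x\<in>I \<inter> {p - e<..<p}. P x)" for e P
    by (metis (no_types, lifting) IntE IntI)+
  then show ?thesis
    unfolding swings_at_def
    by (simp add: sgn_1_pos sgn_1_neg del: greaterThanLessThan_iff Int_iff)
qed

theorem mainTheorem3:
  fixes a b :: real and I :: "real set" and f :: "real \<Rightarrow> real"
  assumes "a < b" and "I = {a..b}" and "f \<in> F1 I"
  shows "universal_in I (F1 I) f \<longleftrightarrow>
    (\<exists>p\<in>I. f p = p \<and>
      (\<forall>\<epsilon>>0. \<exists>x1 \<in> I \<inter> {p<..<p + \<epsilon>}. \<exists>x2 \<in> I \<inter> {p<..<p + \<epsilon>}.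
              \<exists>x3 \<in> I \<inter> {p - \<epsilon><..<p}. \<exists>x4 \<in> I \<inter> {p - \<epsilon><..<p}.
                f x1 > p \<and> f x2 < p \<and> f x3 > p \<and> f x4 < p))"
  unfolding swings_at_iff[symmetric]
  using assms universal_imp_swings[of a b f] swings_imp_universal[of f a b] by blast

end
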